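(* Consider a repeated bidding game in which the two players follow budget strategies with constants $\alpha_1,\alpha_2\in(0,1)$. Then $\mathtt{bif}^\infty$ is finite. Moreover, there exists $$N_0=O\left(\max_{i\ne j\in\{1,2\}}\frac{\log\frac{\alpha_i}{\alpha_i+\alpha_j}}{\log(1-\alpha_j)}\right)$$ such that $\mathtt{bif}^{N_0}=\mathtt{bif}^\infty$.
   Context: A repeated bidding game is a game on a graph with a root $v_0$ having two children $v_1,v_2$, both of which have a single outgoing edge, to $v_0$. Player 1's budget is $x\in[0,1]$ and Player 2's is $1-x$. At each visit to $v_0$ the players bid simultaneously; the higher bidder (ties go to Player 1) moves the token and pays his bid to the other player; no budget changes hands at $v_1,v_2$. Under budget strategies with constants $\alpha_1,\alpha_2\in(0,1)$ (each satisfying $1-\alpha_i=(1+\alpha_i)^{-(1+\varepsilon)}$ for some $\varepsilon>0$), at $v_0$ each Player $i$ bids the fraction $\alpha_i$ of his current budget, so Player 1 bids $\alpha_1x$ and Player 2 bids $\alpha_2(1-x)$. The budget-update function $\mathfrak{B}:[0,1]\to[0,1]$ gives Player 1's budget at the next visit to $v_0$: $$\mathfrak{B}(x)=\begin{cases}(1-\alpha_2)x+\alpha_2 & \text{if } x<\frac{\alpha_2}{\alpha_1+\alpha_2}\\ (1-\alpha_1)x & \text{if } x\ge\frac{\alpha_2}{\alpha_1+\alpha_2}.\end{cases}$$ Its set of bifurcation points (where the linear branch changes) is $\mathtt{bif}^1=\{\frac{\alpha_2}{\alpha_1+\alpha_2}\}$. For $i\ge2$, $\mathtt{bif}^i=\mathtt{bif}^{i-1}\cup\{x\in[0,1]:\mathfrak{B}(x)\in\mathtt{bif}^{i-1}\}$,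 and $\mathtt{bif}^\infty=\bigcup_{i\ge1}\mathtt{bif}^i$.
   Formalization: The bound proved is N_0 = O(max(1, M)), M being the stated maximum, with one constant for all α_1, α_2; O(M) itself fails uniformly, since M tends to 0 when α_1 = α_2 tends to 1 while N_0 ≥ 1. Where M is bounded below the two agree. *)

theory Defs
  imports Complex_Main "HOL-Library.Landau_Symbols"
begin

definition budget_constant :: "real \<Rightarrow> bool" where
  "budget_constant \<alpha> \<longleftrightarrow> \<alpha> \<in> {0<..<1} \<and> (\<exists>\<epsilon>>0. 1 - \<alpha> = (1 + \<alpha>) powr (- (1 + \<epsilon>)))"

text \<open>The equation with \<^term>\<open>\<epsilon>\<close> does not restrict the constant any further:\<close>

lemma budget_constant_iff: "budget_constant \<alpha> \<longleftrightarrow> \<alpha> \<in> {0<..<1}"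
proof
  assume "\<alpha> \<in> {0<..<1}"
  then have a: "0 < \<alpha>" "\<alpha> < 1" by auto
  define \<epsilon> where "\<epsilon> = - ln (1 - \<alpha>) / ln (1 + \<alpha>) - 1"
  have "(1 - \<alpha>) * (1 + \<alpha>) < 1"
    using a by (simp add: algebra_simps)
  then have "ln ((1 - \<alpha>) * (1 + \<alpha>)) < 0"
    using a by simp
  then have "ln (1 - \<alpha>) + ln (1 + \<alpha>) < 0"
    using a by (simp add: ln_mult)
  moreover have l: "ln (1 + \<alpha>) > 0"
    using a by simp
  ultimately have "\<epsilon> > 0"
    by (simp add: \<epsilon>_def field_simps)
  moreover have "(1 + \<alpha>) powr (- (1 + \<epsilon>)) = 1 - \<alpha>"
    using a l by (simp add: powr_def \<epsilon>_def)
  ultimately show "budget_constant \<alpha>"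
    unfolding budget_constant_def using \<open>\<alpha> \<in> {0<..<1}\<close> by metis
qed (simp add: budget_constant_def)

text \<open>
  Player 1's budget after one bidding at the root when the bids are \<^term>\<open>b1\<close> and \<^term>\<open>b2\<close>:
  the higher bidder pays his bid to the other player, and Player 1 wins ties.
\<close>

definition bidding_step :: "real \<Rightarrow> real \<Rightarrow> real \<Rightarrow> real" where
  "bidding_step b1 b2 x = (if b1 \<ge> b2 then x - b1 else x + b2)"

definition bif_point :: "real \<Rightarrow> real \<Rightarrow> real" where
  "bif_point \<alpha>1 \<alpha>2 = \<alpha>2 / (\<alpha>1 + \<alpha>2)"

definition budget_update :: "real \<Rightarrow> real \<Rightarrow> real \<Rightarrow> real" where
  "budget_update \<alpha>1 \<alpha>2 x =
     (if x < bif_point \<alpha>1 \<alpha>2 then (1 - \<alpha>2) * x + \<alpha>2 else (1 - \<alpha>1) * x)"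

text \<open>
  The piecewise formula is the effect of one round of bidding in which each player bids the
  corresponding fraction of his current budget, and it preserves the unit interval.
\<close>

lemma budget_update_eq_bidding_step:
  assumes "\<alpha>1 > 0" "\<alpha>2 > 0"
  shows "budget_update \<alpha>1 \<alpha>2 x = bidding_step (\<alpha>1 * x) (\<alpha>2 * (1 - x)) x"
proof -
  have "x < bif_point \<alpha>1 \<alpha>2 \<longleftrightarrow> \<alpha>1 * x < \<alpha>2 * (1 - x)"
    using assms by (simp add: bif_point_def field_simps)
  then show ?thesis
    by (auto simp: budget_update_def bidding_step_def algebra_simps)
qed

lemma budget_update_in_unit:
  assumes "\<alpha>1 \<in> {0<..<1}" "\<alpha>2 \<in> {0<..<1}" "x \<in> {0..1}"
  shows "budget_update \<alpha>1 \<alpha>2 x \<in> {0..1}"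
proof -
  have "(1 - \<alpha>2) * x \<le> 1 - \<alpha>2" "(1 - \<alpha>1) * x \<le> 1 - \<alpha>1"
      "0 \<le> (1 - \<alpha>1) * x" "0 \<le> (1 - \<alpha>2) * x"
    using assms mult_left_le[of x "1 - \<alpha>1"] mult_left_le[of x "1 - \<alpha>2"] by auto
  moreover have "0 < \<alpha>1" "0 < \<alpha>2"
    using assms by auto
  ultimately show ?thesis
    unfolding budget_update_def atLeastAtMost_iff by (smt (verit))
qed

text \<open>The index starts at 1; the value at 0 is a dummy.\<close>

fun bif :: "real \<Rightarrow> real \<Rightarrow> nat \<Rightarrow> real set" where
  "bif \<alpha>1 \<alpha>2 0 = {}"
| "bif \<alpha>1 \<alpha>2 (Suc 0) = {bif_point \<alpha>1 \<alpha>2}"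
| "bif \<alpha>1 \<alpha>2 (Suc (Suc i)) =
     bif \<alpha>1 \<alpha>2 (Suc i) \<union> {x \<in> {0..1}. budget_update \<alpha>1 \<alpha>2 x \<in> bif \<alpha>1 \<alpha>2 (Suc i)}"

definition bif_inf :: "real \<Rightarrow> real \<Rightarrow> real set" where
  "bif_inf \<alpha>1 \<alpha>2 = (\<Union>i\<in>{1..}. bif \<alpha>1 \<alpha>2 i)"

definition bif_bound :: "real \<Rightarrow> real \<Rightarrow> real" where
  "bif_bound \<alpha>1 \<alpha>2 =
     max (ln (\<alpha>1 / (\<alpha>1 + \<alpha>2)) / ln (1 - \<alpha>2)) (ln (\<alpha>2 / (\<alpha>1 + \<alpha>2)) / ln (1 - \<alpha>1))"

text \<open>
  Landau bounds of the form \<open>O(bif_bound)\<close>, with one constant for all pairs of budget constants,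
  are expressed with \<open>max 1 bif_bound\<close>: any index of the sets \<^const>\<open>bif\<close> is at least 1, whereas
  \<^const>\<open>bif_bound\<close> is positive but tends to 0 when both constants are equal and tend to 1.  Where
  \<open>bif_bound \<ge> 1\<close> the two bounds coincide.
\<close>

abbreviation budget_constant_pairs :: "(real \<times> real) set" where
  "budget_constant_pairs \<equiv> {(\<alpha>1, \<alpha>2). budget_constant \<alpha>1 \<and> budget_constant \<alpha>2}"

end

(* The two one-sided values of the budget update at the bifurcation point p are (1 - \<alpha>1) p and
   (1 + \<alpha>1) p.  A preimage of p lies below the first value or above the second, so it can only be
   reached again through the branch on its own side.  Hence the iterated preimages of p form two
   chains: on one the budget of Player 1 is divided by 1 - \<alpha>1 at each step, on the other the budget
   of Player 2 is divided by 1 - \<alpha>2.  Each chain leaves the unit interval after the number of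
   steps given by the corresponding quotient of logarithms. *)

theory Submission
  imports Defs
begin

text \<open>The branch below \<open>bif_point\<close> is affine with fixed point 1, so its inverse
  scales the distance to 1. Terms may become negative; they are cut off only in
  \<open>bif_Suc_eq_chains\<close>.\<close>

definition lower_chain :: "real \<Rightarrow> real \<Rightarrow> nat \<Rightarrow> real" where
  "lower_chain \<alpha>1 \<alpha>2 k = 1 - \<alpha>1 / (\<alpha>1 + \<alpha>2) / (1 - \<alpha>2) ^ k"

definition upper_chain :: "real \<Rightarrow> real \<Rightarrow> nat \<Rightarrow> real" where
  "upper_chain \<alpha>1 \<alpha>2 k = \<alpha>2 / (\<alpha>1 + \<alpha>2) / (1 - \<alpha>1) ^ k"

lemma le_div_power:
  fixes c q :: real
  assumes "c > 0" "0 < q" "q < 1"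
  shows "c \<le> c / q ^ k"
proof -
  have "q ^ k \<le> 1" "0 < q ^ k"
    using assms by (simp_all add: power_le_one)
  then show ?thesis
    using assms(1) by (simp add: le_divide_eq mult_left_le)
qed

text \<open>Logarithms turn staying inside the unit interval into an index bound;
  \<open>ln q\<close> is negative, so dividing by it reverses the inequality.\<close>

lemma div_power_le_one_imp_le:
  fixes c q :: real
  assumes "c > 0" "0 < q" "q < 1" "c / q ^ k \<le> 1"
  shows "real k \<le> ln c / ln q"
proof -
  have "c \<le> q ^ k"
    using assms by (simp add: divide_le_eq)
  then have "ln c \<le> ln (q ^ k)"
    using assms by simp
  also have "\<dots> = real k * ln q"
    using assms by (simp add: ln_realpow)
  finally show ?thesis
    using assms by (simp add: neg_le_divide_eq)
qed

lemma budget_update_lower_chain: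
  assumes "\<alpha>1 \<in> {0<..<1}" "\<alpha>2 \<in> {0<..<1}"
  shows "budget_update \<alpha>1 \<alpha>2 (lower_chain \<alpha>1 \<alpha>2 (Suc k)) = lower_chain \<alpha>1 \<alpha>2 k"
proof -
  define c where "c = \<alpha>1 / (\<alpha>1 + \<alpha>2)"
  have c: "c > 0" "bif_point \<alpha>1 \<alpha>2 = 1 - c"
    using assms by (auto simp: c_def bif_point_def field_simps)
  \<comment> \<open>Ties take the other branch, so the point must lie strictly below
    \<open>bif_point\<close>; the first division by \<open>1 - \<alpha>2\<close> supplies the
    strictness.\<close>
  have "c < c / (1 - \<alpha>2)"
    using c assms by (simp add: field_simps)
  also have "\<dots> \<le> c / (1 - \<alpha>2) / (1 - \<alpha>2) ^ k"
    using le_div_power[of "c / (1 - \<alpha>2)" "1 - \<alpha>2" k] c assms by simp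
  finally have "lower_chain \<alpha>1 \<alpha>2 (Suc k) < bif_point \<alpha>1 \<alpha>2"
    by (simp add: c lower_chain_def flip: c_def)
  moreover have "(1 - \<alpha>2) * (c / (1 - \<alpha>2) ^ Suc k) = c / (1 - \<alpha>2) ^ k"
    using assms by simp
  ultimately show ?thesis
    by (simp add: budget_update_def lower_chain_def right_diff_distrib flip: c_def)
qed

lemma budget_update_upper_chain:
  assumes "\<alpha>1 \<in> {0<..<1}" "\<alpha>2 \<in> {0<..<1}"
  shows "budget_update \<alpha>1 \<alpha>2 (upper_chain \<alpha>1 \<alpha>2 (Suc k)) = upper_chain \<alpha>1 \<alpha>2 k"
proof -
  have "bif_point \<alpha>1 \<alpha>2 > 0"
    using assms by (simp add: bif_point_def)
  then have "bif_point \<alpha>1 \<alpha>2 \<le> upper_chain \<alpha>1 \<alpha>2 (Suc k)"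
    using le_div_power[of "bif_point \<alpha>1 \<alpha>2" "1 - \<alpha>1" "Suc k"] assms
    by (simp add: upper_chain_def bif_point_def)
  then show ?thesis
    using assms by (simp add: budget_update_def upper_chain_def)
qed

text \<open>Below \<open>bif_point\<close> the branch is injective, and solving for \<open>x\<close>
  yields the next term. The other branch takes no value below
  \<open>(1 - \<alpha>1) * bif_point \<alpha>1 \<alpha>2\<close>, while every term with
  \<open>k > 0\<close> is smaller than that; only the common start \<open>k = 0\<close> has a
  preimage there, and it lies on the upper chain.\<close>

lemma budget_update_eq_lower_chain:
  assumes "\<alpha>1 \<in> {0<..<1}" "\<alpha>2 \<in> {0<..<1}"
    and eq: "budget_update \<alpha>1 \<alpha>2 x = lower_chain \<alpha>1 \<alpha>2 k"
  shows "x \<in> {lower_chain \<alpha>1 \<alpha>2 (Suc k), upper_chain \<alpha>1 \<alpha>2 (Suc k)}"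
proof (cases "x < bif_point \<alpha>1 \<alpha>2")
  case True
  then have "(1 - \<alpha>2) * (1 - x) = 1 - lower_chain \<alpha>1 \<alpha>2 k"
    using eq by (simp add: budget_update_def algebra_simps)
  then have "1 - x = (1 - lower_chain \<alpha>1 \<alpha>2 k) / (1 - \<alpha>2)"
    using assms by (simp add: eq_divide_eq mult.commute)
  also have "\<dots> = 1 - lower_chain \<alpha>1 \<alpha>2 (Suc k)"
    by (simp add: lower_chain_def mult.commute)
  finally show ?thesis
    by simp
next
  case False
  define p c where "p = \<alpha>2 / (\<alpha>1 + \<alpha>2)" and "c = \<alpha>1 / (\<alpha>1 + \<alpha>2)"
  have c: "c > 0" "1 - c = p" "\<alpha>1 * p = \<alpha>2 * c"
    using assms by (auto simp: p_def c_def field_simps)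
  have x: "(1 - \<alpha>1) * x = lower_chain \<alpha>1 \<alpha>2 k" "p \<le> x"
    using False eq by (auto simp: budget_update_def bif_point_def p_def)
  show ?thesis
  proof (cases k)
    case 0
    then show ?thesis
      using x(1) c assms
      by (simp add: lower_chain_def upper_chain_def eq_divide_eq mult.commute flip: p_def c_def)
  next
    case (Suc j)
    \<comment> \<open>The upper branch lowers \<open>p\<close> by \<open>\<alpha>1 * p\<close>,
      which equals \<open>\<alpha>2 * c\<close>. The chain has already fallen below \<open>p\<close>
      by more than this.\<close>
    have "\<alpha>2 * c < c * (\<alpha>2 / (1 - \<alpha>2))"
      using c assms by (simp add: field_simps)
    also have "\<dots> = c / (1 - \<alpha>2) - c"
      using assms by (simp add: field_simps)
    also have "\<dots> \<le> c / (1 - \<alpha>2) / (1 - \<alpha>2) ^ j - c"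
      using le_div_power[of "c / (1 - \<alpha>2)" "1 - \<alpha>2" j] c assms by simp
    also have "\<dots> = p - lower_chain \<alpha>1 \<alpha>2 k"
      by (simp add: Suc lower_chain_def c(2)[symmetric] flip: c_def)
    finally have "lower_chain \<alpha>1 \<alpha>2 k < (1 - \<alpha>1) * p"
      using c by (simp add: algebra_simps)
    also have "\<dots> \<le> (1 - \<alpha>1) * x"
      using x(2) assms by (simp add: mult_left_mono)
    finally show ?thesis
      using x(1) by simp
  qed
qed

text \<open>Mirror image of the previous argument: the branch below the bifurcation point
  \<open>p\<close> stays strictly under its one-sided limit \<open>(1 + \<alpha>1) * p\<close>, and
  \<open>(1 + \<alpha>1) * (1 - \<alpha>1) \<le> 1\<close> places that limit at or below every term
  with \<open>k > 0\<close>.\<close>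

lemma budget_update_eq_upper_chain:
  assumes "\<alpha>1 \<in> {0<..<1}" "\<alpha>2 \<in> {0<..<1}"
    and eq: "budget_update \<alpha>1 \<alpha>2 x = upper_chain \<alpha>1 \<alpha>2 k"
  shows "x \<in> {lower_chain \<alpha>1 \<alpha>2 (Suc k), upper_chain \<alpha>1 \<alpha>2 (Suc k)}"
proof (cases "x < bif_point \<alpha>1 \<alpha>2")
  case False
  then have "x = upper_chain \<alpha>1 \<alpha>2 k / (1 - \<alpha>1)"
    using eq assms by (simp add: budget_update_def eq_divide_eq mult.commute)
  then show ?thesis
    by (simp add: upper_chain_def mult.commute)
next
  case True
  define p where "p = \<alpha>2 / (\<alpha>1 + \<alpha>2)"
  \<comment> \<open>The bids agree at \<open>p\<close>, that is
    \<open>\<alpha>1 * p = \<alpha>2 * (1 - p)\<close>, so the gain from Player 2's bid can be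
    expressed through \<open>\<alpha>1\<close>.\<close>
  have p: "p > 0" "(1 - \<alpha>2) * p + \<alpha>2 = (1 + \<alpha>1) * p"
    using assms by (auto simp: p_def field_simps)
  show ?thesis
  proof (cases k)
    case 0
    \<comment> \<open>The two chains share their start, so this case reduces to the lower
      chain.\<close>
    have "\<alpha>1 + \<alpha>2 \<noteq> 0"
      using assms by auto
    then have "upper_chain \<alpha>1 \<alpha>2 0 = lower_chain \<alpha>1 \<alpha>2 0"
      by (simp add: upper_chain_def lower_chain_def field_simps)
    then show ?thesis
      using budget_update_eq_lower_chain[OF assms(1,2), of x 0] eq 0 by simp
  next
    case (Suc j)
    have "(1 - \<alpha>2) * x < (1 - \<alpha>2) * p"
      using True assms by (intro mult_strict_left_mono) (auto simp: bif_point_def p_def)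
    then have "upper_chain \<alpha>1 \<alpha>2 k < (1 + \<alpha>1) * p"
      using True eq p(2) by (simp add: budget_update_def)
    also have "\<dots> \<le> p / (1 - \<alpha>1)"
      using p(1) assms by (simp add: field_simps)
    also have "\<dots> \<le> upper_chain \<alpha>1 \<alpha>2 k"
      using le_div_power[of "p / (1 - \<alpha>1)" "1 - \<alpha>1" j] p(1) assms
      by (simp add: Suc upper_chain_def flip: p_def)
    finally show ?thesis
      by simp
  qed
qed

text \<open>Taking preimages advances the chain index by one. Chain indices lag one behind those of
  \<open>bif\<close>, since the chains start at 0 and \<open>bif\<close> at 1.\<close>

lemma bif_Suc_eq_chains:
  assumes "\<alpha>1 \<in> {0<..<1}" "\<alpha>2 \<in> {0<..<1}"
  shows "bif \<alpha>1 \<alpha>2 (Suc n) =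
    {0..1} \<inter> (lower_chain \<alpha>1 \<alpha>2 ` {..n} \<union> upper_chain \<alpha>1 \<alpha>2 ` {..n})"
proof (induction n)
  case 0
  have "lower_chain \<alpha>1 \<alpha>2 0 = bif_point \<alpha>1 \<alpha>2" "upper_chain \<alpha>1 \<alpha>2 0 = bif_point \<alpha>1 \<alpha>2"
      "bif_point \<alpha>1 \<alpha>2 \<in> {0..1}"
    using assms by (auto simp: lower_chain_def upper_chain_def bif_point_def field_simps)
  then show ?case
    by auto
next
  case (Suc n)
  have "budget_update \<alpha>1 \<alpha>2 x \<in> bif \<alpha>1 \<alpha>2 (Suc n) \<longleftrightarrow>
      (\<exists>k\<le>n. x = lower_chain \<alpha>1 \<alpha>2 (Suc k) \<or> x = upper_chain \<alpha>1 \<alpha>2 (Suc k))"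
    if "x \<in> {0..1}" for x
  proof
    assume "budget_update \<alpha>1 \<alpha>2 x \<in> bif \<alpha>1 \<alpha>2 (Suc n)"
    then obtain k where "k \<le> n"
        "budget_update \<alpha>1 \<alpha>2 x = lower_chain \<alpha>1 \<alpha>2 k \<or>
         budget_update \<alpha>1 \<alpha>2 x = upper_chain \<alpha>1 \<alpha>2 k"
      unfolding Suc.IH by auto
    then show "\<exists>k\<le>n. x = lower_chain \<alpha>1 \<alpha>2 (Suc k) \<or> x = upper_chain \<alpha>1 \<alpha>2 (Suc k)"
      using budget_update_eq_lower_chain[OF assms] budget_update_eq_upper_chain[OF assms] by blast
  next
    assume "\<exists>k\<le>n. x = lower_chain \<alpha>1 \<alpha>2 (Suc k) \<or> x = upper_chain \<alpha>1 \<alpha>2 (Suc k)"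
    then obtain k where "k \<le> n"
        "x = lower_chain \<alpha>1 \<alpha>2 (Suc k) \<or> x = upper_chain \<alpha>1 \<alpha>2 (Suc k)"
      by blast
    \<comment> \<open>The induction hypothesis also asks for the image to lie in the unit interval.
      It does because \<open>budget_update\<close> preserves that interval, so a chain that has left
      it never re-enters.\<close>
    then show "budget_update \<alpha>1 \<alpha>2 x \<in> bif \<alpha>1 \<alpha>2 (Suc n)"
      unfolding Suc.IH
      using budget_update_in_unit[OF assms that]
        budget_update_lower_chain[OF assms, of k] budget_update_upper_chain[OF assms, of k]
      by auto
  qed
  then have "bif \<alpha>1 \<alpha>2 (Suc (Suc n)) = bif \<alpha>1 \<alpha>2 (Suc n) \<union>
      {0..1} \<inter> (lower_chain \<alpha>1 \<alpha>2 ` Suc ` {..n} \<union> upper_chain \<alpha>1 \<alpha>2 ` Suc ` {..n})"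
    by auto
  also have "\<dots> = {0..1} \<inter>
      (lower_chain \<alpha>1 \<alpha>2 ` ({..n} \<union> Suc ` {..n}) \<union> upper_chain \<alpha>1 \<alpha>2 ` ({..n} \<union> Suc ` {..n}))"
    unfolding Suc.IH image_Un by blast
  also have "{..n} \<union> Suc ` {..n} = {..Suc n}"
    by (auto simp: image_Suc_atMost)
  finally show ?case .
qed

text \<open>Each alternative says that some \<open>c / q ^ k\<close> is at most 1. Either one
  suffices because \<open>bif_bound\<close> is the maximum of the two resulting bounds.\<close>

lemma chain_index_le_bif_bound:
  assumes "\<alpha>1 \<in> {0<..<1}" "\<alpha>2 \<in> {0<..<1}"
    and "lower_chain \<alpha>1 \<alpha>2 k \<ge> 0 \<or> upper_chain \<alpha>1 \<alpha>2 k \<le> 1"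
  shows "real k \<le> bif_bound \<alpha>1 \<alpha>2"
  using assms
    div_power_le_one_imp_le[of "\<alpha>1 / (\<alpha>1 + \<alpha>2)" "1 - \<alpha>2" k]
    div_power_le_one_imp_le[of "\<alpha>2 / (\<alpha>1 + \<alpha>2)" "1 - \<alpha>1" k]
  by (auto simp: lower_chain_def upper_chain_def bif_bound_def)

text \<open>Chain indices inside the unit interval are naturals bounded by \<open>bif_bound\<close>,
  hence by its floor; \<open>Suc\<close> accounts for the index shift between the chains and
  \<open>bif\<close>.\<close>

lemma bif_eq_bif_inf:
  assumes "\<alpha>1 \<in> {0<..<1}" "\<alpha>2 \<in> {0<..<1}"
  shows "bif \<alpha>1 \<alpha>2 (Suc (nat \<lfloor>bif_bound \<alpha>1 \<alpha>2\<rfloor>)) = bif_inf \<alpha>1 \<alpha>2"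
proof
  show "bif_inf \<alpha>1 \<alpha>2 \<subseteq> bif \<alpha>1 \<alpha>2 (Suc (nat \<lfloor>bif_bound \<alpha>1 \<alpha>2\<rfloor>))"
  proof
    fix x assume "x \<in> bif_inf \<alpha>1 \<alpha>2"
    then obtain n where "x \<in> bif \<alpha>1 \<alpha>2 (Suc n)"
      unfolding bif_inf_def by (metis UN_E atLeast_iff Suc_le_D One_nat_def)
    then obtain k where x: "x \<in> {0..1}" "x = lower_chain \<alpha>1 \<alpha>2 k \<or> x = upper_chain \<alpha>1 \<alpha>2 k"
      unfolding bif_Suc_eq_chains[OF assms] by auto
    then have "real k \<le> bif_bound \<alpha>1 \<alpha>2"
      using chain_index_le_bif_bound[OF assms] by auto
    then have "k \<le> nat \<lfloor>bif_bound \<alpha>1 \<alpha>2\<rfloor>"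
      by (simp add: le_nat_floor)
    then show "x \<in> bif \<alpha>1 \<alpha>2 (Suc (nat \<lfloor>bif_bound \<alpha>1 \<alpha>2\<rfloor>))"
      unfolding bif_Suc_eq_chains[OF assms] using x by auto
  qed
qed (auto simp: bif_inf_def)

theorem theorem16:
  shows "(\<forall>(\<alpha>1, \<alpha>2) \<in> budget_constant_pairs. finite (bif_inf \<alpha>1 \<alpha>2)) \<and>
    (\<exists>N0 :: real \<Rightarrow> real \<Rightarrow> nat.
       (\<forall>(\<alpha>1, \<alpha>2) \<in> budget_constant_pairs.
          N0 \<alpha>1 \<alpha>2 \<ge> 1 \<and> bif \<alpha>1 \<alpha>2 (N0 \<alpha>1 \<alpha>2) = bif_inf \<alpha>1 \<alpha>2) \<and>
       (\<lambda>(\<alpha>1, \<alpha>2). real (N0 \<alpha>1 \<alpha>2))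
          \<in> O[principal budget_constant_pairs](\<lambda>(\<alpha>1, \<alpha>2). max 1 (bif_bound \<alpha>1 \<alpha>2)))"
proof (intro conjI exI)
  let ?N0 = "\<lambda>\<alpha>1 \<alpha>2. Suc (nat \<lfloor>bif_bound \<alpha>1 \<alpha>2\<rfloor>)"
  show "\<forall>(\<alpha>1, \<alpha>2) \<in> budget_constant_pairs.
      ?N0 \<alpha>1 \<alpha>2 \<ge> 1 \<and> bif \<alpha>1 \<alpha>2 (?N0 \<alpha>1 \<alpha>2) = bif_inf \<alpha>1 \<alpha>2"
    using bif_eq_bif_inf by (auto simp: budget_constant_iff simp del: bif.simps)
  have "finite (bif_inf \<alpha>1 \<alpha>2)" if "budget_constant \<alpha>1" "budget_constant \<alpha>2" for \<alpha>1 \<alpha>2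
  proof -
    have \<alpha>: "\<alpha>1 \<in> {0<..<1}" "\<alpha>2 \<in> {0<..<1}"
      using that by (simp_all only: budget_constant_iff)
    show ?thesis
      unfolding bif_eq_bif_inf[OF \<alpha>, symmetric] bif_Suc_eq_chains[OF \<alpha>] by simp
  qed
  then show "\<forall>(\<alpha>1, \<alpha>2) \<in> budget_constant_pairs. finite (bif_inf \<alpha>1 \<alpha>2)"
    by blast
  \<comment> \<open>The floor and the added 1 are each at most the maximum; a negative floor becomes
    0 under \<open>nat\<close>.\<close>
  have "real (?N0 \<alpha>1 \<alpha>2) \<le> 2 * max 1 (bif_bound \<alpha>1 \<alpha>2)" for \<alpha>1 \<alpha>2
    by linarith
  then show "(\<lambda>(\<alpha>1, \<alpha>2). real (?N0 \<alpha>1 \<alpha>2))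
      \<in> O[principal budget_constant_pairs](\<lambda>(\<alpha>1, \<alpha>2). max 1 (bif_bound \<alpha>1 \<alpha>2))"
    \<comment> \<open>Over a principal filter the estimate must hold at every pair of the set, so
      the constant 2 is uniform.\<close>
    by (intro bigoI[where c = 2]) (auto simp: eventually_principal)
qed

end
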